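(* Let $n \geq 5$. Then the circulant graph $C(n,\{1,2\})$ is nearly dispersable.
   Context: All graphs are finite and simple. For a set $S=\{i_1<\cdots<i_k\}$ of integers with $k\ge 1$, $1\le i_1$ and $i_k\le \lfloor n/2\rfloor$, the circulant $C(n,S)$ is the graph on vertex set $\{1,\ldots,n\}$ in which each $j$ is adjacent to $j+i_r$ (addition mod $n$) for $r=1,\ldots,k$. Given a graph $G$ and a cyclic order $\omega$ on $V(G)$, draw the vertices on a circle in the order $\omega$ and the edges as straight chords; two edges cross if they intersect at a point that is not an endpoint. A matching book embedding $(G,\omega,c)$ consists of $G$, a cyclic order $\omega$, and an edge-coloring $c$ (the color classes are the pages) such that any two distinct edges of the same color neither cross nor share an endpoint. The embedding is dispersable if the number of colors equals the maximum degree $\Delta(G)$, and nearly dispersable if the number of colors equals $1+\Delta(G)$. A graph is dispersable if it has a dispersable matching book embedding; it is nearly dispersable if it is not dispersable and has a nearly dispersable matching book embedding. *)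

theory Defs
  imports "HOL-Analysis.Analysis" "HOL-Number_Theory.Cong"
begin

type_synonym 'a ugraph = "'a set \<times> 'a set set"

abbreviation verts :: "'a ugraph \<Rightarrow> 'a set" where
  "verts G \<equiv> fst G"

abbreviation edges :: "'a ugraph \<Rightarrow> 'a set set" where
  "edges G \<equiv> snd G"

definition simple_graph :: "'a ugraph \<Rightarrow> bool" where
  "simple_graph G \<longleftrightarrow>
     finite (verts G) \<and> (\<forall>e\<in>edges G. e \<subseteq> verts G \<and> card e = 2)"

definition degree :: "'a ugraph \<Rightarrow> 'a \<Rightarrow> nat" where
  "degree G v = card {e \<in> edges G. v \<in> e}"

definition max_degree :: "'a ugraph \<Rightarrow> nat" where
  "max_degree G = Max (degree G ` verts G)"

(* The vertex set is {1..n}, so addition mod n takes its representative there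
   (n itself, not 0). *)
definition circulant :: "nat \<Rightarrow> nat set \<Rightarrow> nat ugraph" where
  "circulant n S =
     ({1..n}, {{j, k} | j k. j \<in> {1..n} \<and> k \<in> {1..n} \<and> (\<exists>s\<in>S. [k = j + s] (mod n))})"

lemma simple_graph_circulant:
  assumes "S \<subseteq> {1..n div 2}"
  shows "simple_graph (circulant n S)"
proof -
  have "j \<noteq> k"
    if "j \<in> {1..n}" "s \<in> S" "[k = j + s] (mod n)" for j k s :: nat
  proof
    assume "j = k"
    with that have "[j + s = j + 0] (mod n)" by (simp add: cong_sym_eq)
    then have "n dvd s" by (simp only: cong_add_lcancel_nat cong_0_iff)
    moreover have "0 < s" "s < n" using assms that by fastforce+
    ultimately show False by (simp add: nat_dvd_not_less)
  qed
  then have "e \<subseteq> {1..n} \<and> card e = 2" if "e \<in> edges (circulant n S)" for e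
    using that unfolding circulant_def by (auto simp: card_insert_if)
  then show ?thesis
    by (simp add: simple_graph_def circulant_def)
qed

(* A cyclic order is given by numbering the vertices 0, ..., |V| - 1 along the
   circle. Numberings that differ by a rotation describe the same cyclic order and
   have the same crossings. *)
definition cyclic_order :: "'a set \<Rightarrow> ('a \<Rightarrow> nat) \<Rightarrow> bool" where
  "cyclic_order V \<omega> \<longleftrightarrow> bij_betw \<omega> V {0..<card V}"

(* Vertices are drawn at the |V|-th roots of unity. *)
definition point :: "'a ugraph \<Rightarrow> ('a \<Rightarrow> nat) \<Rightarrow> 'a \<Rightarrow> complex" where
  "point G \<omega> v = cis (2 * pi * real (\<omega> v) / real (card (verts G)))"

(* For an edge {u, v} the convex hull is the closed segment between the two points. *)
definition chord :: "'a ugraph \<Rightarrow> ('a \<Rightarrow> nat) \<Rightarrow> 'a set \<Rightarrow> complex set" where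
  "chord G \<omega> e = convex hull (point G \<omega> ` e)"

definition edges_cross :: "'a ugraph \<Rightarrow> ('a \<Rightarrow> nat) \<Rightarrow> 'a set \<Rightarrow> 'a set \<Rightarrow> bool" where
  "edges_cross G \<omega> e f \<longleftrightarrow>
     (\<exists>z \<in> chord G \<omega> e \<inter> chord G \<omega> f. z \<notin> point G \<omega> ` e \<union> point G \<omega> ` f)"

definition matching_book_embedding ::
    "'a ugraph \<Rightarrow> ('a \<Rightarrow> nat) \<Rightarrow> ('a set \<Rightarrow> nat) \<Rightarrow> bool" where
  "matching_book_embedding G \<omega> c \<longleftrightarrow>
     simple_graph G \<and> cyclic_order (verts G) \<omega> \<and>
     (\<forall>e\<in>edges G. \<forall>f\<in>edges G.
        e \<noteq> f \<and> c e = c f \<longrightarrow> \<not> edges_cross G \<omega> e f \<and> e \<inter> f = {})"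

definition num_colors :: "'a ugraph \<Rightarrow> ('a set \<Rightarrow> nat) \<Rightarrow> nat" where
  "num_colors G c = card (c ` edges G)"

definition dispersable :: "'a ugraph \<Rightarrow> bool" where
  "dispersable G \<longleftrightarrow>
     (\<exists>\<omega> c. matching_book_embedding G \<omega> c \<and> num_colors G c = max_degree G)"

definition nearly_dispersable :: "'a ugraph \<Rightarrow> bool" where
  "nearly_dispersable G \<longleftrightarrow>
     \<not> dispersable G \<and>
     (\<exists>\<omega> c. matching_book_embedding G \<omega> c \<and> num_colors G c = 1 + max_degree G)"

end

theory Submission
  imports Defs
begin

text \<open>
  In a dispersable embedding of a regular graph every page is a non-crossing perfect matching,
  so an even number of vertices lies below each edge and its ends have positions of different
  parity. This is impossible for the triangle on 1, 2, 3.

  For five pages, take the natural order. A page that contains \<open>{i, i + 2}\<close> cannot use the vertex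
  \<open>i + 1\<close>, so such an edge blocks 3 vertices and an edge \<open>{i, i + 1}\<close> blocks 2. Since
  \<open>3 n + 2 n = 5 n\<close>, the five pages must be five exact tilings of the cycle by blocks of
  lengths 2 and 3. Periodic tilings built from words of lengths 5, 6, 8, 9 and 12 cover
  every n except 7. For n = 7 each tiling has a single 3-block, so five pages carry only
  five of the seven edges \<open>{i, i + 2}\<close>, and another vertex order is needed.
\<close>

section \<open>Crossing chords of the unit circle\<close>

text \<open>Twice the signed area of the triangle \<open>P\<close>, \<open>Q\<close>,
  \<open>X\<close>. Its sign tells on which side of the line through \<open>P\<close> and
  \<open>Q\<close> the point \<open>X\<close> lies.\<close>

definition orient :: "complex \<Rightarrow> complex \<Rightarrow> complex \<Rightarrow> real" where
  "orient P Q X = (Re Q - Re P) * (Im X - Im P) - (Im Q - Im P) * (Re X - Re P)"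

lemma orient_convex_combination:
  "orient P Q ((1 - t) *\<^sub>R R + t *\<^sub>R S) = (1 - t) * orient P Q R + t * orient P Q S"
  by (simp add: orient_def algebra_simps)

lemma orient_endpoint [simp]: "orient P Q P = 0" "orient P Q Q = 0"
  by (simp_all add: orient_def algebra_simps)

text \<open>\<open>orient P Q\<close> is affine and vanishes on the line through \<open>P\<close>
  and \<open>Q\<close>. On the segment from \<open>R\<close> to \<open>S\<close> it is a convex
  combination of two nonzero values of the same sign, hence never 0.\<close>

lemma segments_disjoint_same_side:
  assumes "orient P Q R * orient P Q S > 0"
  shows "closed_segment P Q \<inter> closed_segment R S = {}"
proof -
  have False if "z \<in> closed_segment P Q" "z \<in> closed_segment R S" for z
  proof -
    from that obtain t where t: "0 \<le> t" "t \<le> 1" "z = (1 - t) *\<^sub>R R + t *\<^sub>R S"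
      by (auto simp: in_segment)
    from that obtain u where "z = (1 - u) *\<^sub>R P + u *\<^sub>R Q"
      by (auto simp: in_segment)
    then have "orient P Q z = 0"
      by (simp only: orient_convex_combination orient_endpoint)
    then have "(1 - t) * orient P Q R + t * orient P Q S = 0"
      using t by (simp add: orient_convex_combination)
    \<comment> \<open>Multiplying by \<open>orient P Q R\<close> makes both products positive, which
      avoids a case distinction on the common sign.\<close>
    then have "(1 - t) * (orient P Q R * orient P Q R) + t * (orient P Q R * orient P Q S) = 0"
      by (metis (no_types, opaque_lifting) distrib_left mult.left_commute mult_zero_right)
    moreover have "0 < orient P Q R * orient P Q R"
      using assms by (metis mult_zero_left not_real_square_gt_zero order_less_irrefl)
    ultimately show False
      using assms t
      by (metis add_nonneg_pos add_pos_nonneg diff_ge_0_iff_ge diff_gt_0_iff_gt linorder_neqE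
          mult_nonneg_nonneg mult_pos_pos not_less order_less_imp_le order_less_irrefl zero_less_one)
  qed
  then show ?thesis by blast
qed

text \<open>The common point is given explicitly by Cramer's rule; the sign conditions place both of
  its parameters in the unit interval.\<close>

lemma segments_cross_opposite_sides:
  assumes PQ: "orient P Q R * orient P Q S < 0" and RS: "orient R S P * orient R S Q < 0"
  obtains z where "z \<in> closed_segment P Q" "z \<in> closed_segment R S" "z \<notin> {P, Q, R, S}"
proof -
  define a b c d where "a = orient P Q R" and "b = orient P Q S"
    and "c = orient R S P" and "d = orient R S Q"
  note defs = a_def b_def c_def d_def
  \<comment> \<open>\<open>t\<close> is the zero of \<open>orient P Q\<close> along
    \<open>R\<close>, \<open>S\<close>, and \<open>u\<close> the zero of \<open>orient R S\<close>
    along \<open>P\<close>, \<open>Q\<close>.\<close>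
  define t u where "t = a / (a - b)" and "u = c / (c - d)"
  have ab: "a * b < 0" and cd: "c * d < 0"
    using PQ RS by (simp_all add: defs)
  have t: "0 \<le> t" "t \<le> 1" and u: "0 \<le> u" "u \<le> 1"
    using ab cd by (auto simp: t_def u_def divide_simps mult_less_0_iff)
  \<comment> \<open>Up to sign, both differences are the cross product of the two direction
    vectors.\<close>
  have D: "c - d = -(a - b)"
    by (simp add: defs orient_def algebra_simps)
  have ne: "a - b \<noteq> 0"
    using ab by (auto simp: mult_less_0_iff)
  have "a * Re S - b * Re R = d * Re P - c * Re Q" "a * Im S - b * Im R = d * Im P - c * Im Q"
    by (simp_all add: defs orient_def algebra_simps)
  moreover have "(1 - t) * x + t * y = (a * y - b * x) / (a - b)"
    "(1 - u) * x + u * y = (d * x - c * y) / (a - b)" for x y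
  proof -
    have u: "u = - c / (a - b)"
      by (metis D u_def minus_divide_left minus_divide_right)
    have "d = c + (a - b)"
      using D by simp
    then have "1 - u = d / (a - b)" "1 - t = - b / (a - b)"
      using ne by (simp_all add: u t_def field_simps)
    with u show "(1 - t) * x + t * y = (a * y - b * x) / (a - b)"
      "(1 - u) * x + u * y = (d * x - c * y) / (a - b)"
      by (simp_all add: t_def diff_divide_distrib)
  qed
  ultimately have eq: "(1 - t) *\<^sub>R R + t *\<^sub>R S = (1 - u) *\<^sub>R P + u *\<^sub>R Q"
    by (simp add: complex_eq_iff)
  define z where "z = (1 - t) *\<^sub>R R + t *\<^sub>R S"
  have "z \<in> closed_segment R S" "z \<in> closed_segment P Q"
    using t u eq by (auto simp: z_def in_segment)
  moreover have "orient R S z = 0"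
    by (simp add: z_def orient_convex_combination)
  moreover have "orient P Q z = 0"
    by (simp add: z_def eq orient_convex_combination)
  \<comment> \<open>Both orientations vanish at \<open>z\<close>, but \<open>orient P Q\<close> is
    nonzero at \<open>R\<close> and \<open>S\<close>, and \<open>orient R S\<close> at
    \<open>P\<close> and \<open>Q\<close>.\<close>
  ultimately show ?thesis
    using that PQ RS by fastforce
qed

text \<open>The area formula for a triangle inscribed in the unit circle. Doubled angles keep the
  sines free of fractions; sum-to-product formulas factor each coordinate difference.\<close>

lemma orient_cis:
  "orient (cis (2 * a)) (cis (2 * b)) (cis (2 * c)) = 4 * sin (b - a) * sin (c - b) * sin (c - a)"
proof -
  have *: "cos (2 * x) - cos (2 * y) = 2 * (sin (x + y) * sin (y - x))"
    "sin (2 * x) - sin (2 * y) = 2 * (cos (x + y) * sin (x - y))" for x y :: real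
  proof -
    have h: "(2 * x + 2 * y) / 2 = x + y" "(2 * x - 2 * y) / 2 = x - y" "(2 * y - 2 * x) / 2 = y - x"
      by simp_all
    then show "cos (2 * x) - cos (2 * y) = 2 * (sin (x + y) * sin (y - x))"
      "sin (2 * x) - sin (2 * y) = 2 * (cos (x + y) * sin (x - y))"
      using cos_diff_cos[of "2 * x" "2 * y"] sin_diff_sin[of "2 * x" "2 * y"]
      unfolding h by (simp_all only: mult_ac)
  qed
  have "orient (cis (2 * a)) (cis (2 * b)) (cis (2 * c)) =
      (2 * (sin (b + a) * sin (a - b))) * (2 * (cos (c + a) * sin (c - a))) -
      (2 * (cos (b + a) * sin (b - a))) * (2 * (sin (c + a) * sin (a - c)))"
    by (simp only: orient_def cis.simps *)
  also have "\<dots> = 4 * sin (b - a) * sin (c - a) * (sin (c + a) * cos (b + a) - cos (c + a) * sin (b + a))"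
    using sin_minus[of "b - a"] sin_minus[of "c - a"] by (simp add: algebra_simps)
  also have "sin (c + a) * cos (b + a) - cos (c + a) * sin (b + a) = sin (c - b)"
    using sin_diff[of "c + a" "b + a"] by simp
  finally show ?thesis by (simp add: mult_ac)
qed

text \<open>The angle lies strictly between \<open>-pi\<close> and \<open>pi\<close>, where the sine
  has the sign of its argument.\<close>

lemma sgn_sin_position:
  assumes "p < N" "q < (N :: nat)"
  shows "sgn (sin (pi * real q / real N - pi * real p / real N)) = sgn (real q - real p)"
proof -
  have *: "sin (pi * real q / real N - pi * real p / real N) > 0"
    if "p < q" "q < N" for p q
  proof (rule sin_gt_zero)
    show "0 < pi * real q / real N - pi * real p / real N"
      using that by (simp add: field_simps)
    have "pi * (real q - real p) < pi * real N"
      using that by (intro mult_strict_left_mono) auto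
    then show "pi * real q / real N - pi * real p / real N < pi"
      using that by (simp add: field_simps)
  qed
  show ?thesis
    using *[of p q] *[of q p] assms
      sin_minus[of "pi * real q / real N - pi * real p / real N"]
    by (cases p q rule: linorder_cases) (auto simp: sgn_if)
qed

text \<open>One of the two open arcs cut off by a chord: the one that avoids the step from the last
  position back to 0. Both orders of \<open>p\<close> and \<open>q\<close> occur because edges are
  unordered.\<close>

definition strictly_between :: "nat \<Rightarrow> nat \<Rightarrow> nat \<Rightarrow> bool" where
  "strictly_between p q r \<longleftrightarrow> p < r \<and> r < q \<or> q < r \<and> r < p"

text \<open>Separation is the parity of the four comparisons of \<open>x\<close>, \<open>y\<close>
  with \<open>p\<close>, \<open>q\<close>. Exchanging the two pairs reverses all four, which
  preserves the parity.\<close>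

lemma strictly_between_swap:
  assumes "strictly_between p q x \<noteq> strictly_between p q y" "distinct [p, q, x, y]"
  shows "strictly_between x y p \<noteq> strictly_between x y q"
proof -
  have *: "strictly_between a b c \<longleftrightarrow> \<not> (c < a \<longleftrightarrow> c < b)" if "c \<noteq> a" "c \<noteq> b" for a b c
    using that by (auto simp: strictly_between_def)
  have "\<not> x < p \<longleftrightarrow> p < x" "\<not> x < q \<longleftrightarrow> q < x" "\<not> y < p \<longleftrightarrow> p < y" "\<not> y < q \<longleftrightarrow> q < y"
    using assms(2) by auto
  then show ?thesis
    using assms by (simp add: *) blast
qed

section \<open>Sides of a chord between roots of unity\<close>

lemma orient_roots_of_unity:
  assumes "p < N" "q < N" "r < N"
  shows "sgn (orient (cis (2 * pi * real p / real N)) (cis (2 * pi * real q / real N))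
      (cis (2 * pi * real r / real N))) =
    sgn (real q - real p) * sgn (real r - real q) * sgn (real r - real p)"
  using orient_cis[of "pi * real p / real N" "pi * real q / real N" "pi * real r / real N"] assms
  by (simp add: sgn_mult sgn_sin_position mult.assoc)

text \<open>Each orientation has the sign of \<open>q - p\<close> times a sign that depends only on
  betweenness; the first factor squares to 1 in the product.\<close>

lemma orient_mult_roots_of_unity:
  assumes "p < N" "q < N" "r < N" "s < N" "distinct [p, q, r, s]"
  defines "P \<equiv> \<lambda>k. cis (2 * pi * real k / real N)"
  shows "orient (P p) (P q) (P r) * orient (P p) (P q) (P s) > 0 \<longleftrightarrow>
      strictly_between p q r = strictly_between p q s"
    and "orient (P p) (P q) (P r) * orient (P p) (P q) (P s) < 0 \<longleftrightarrow>
      strictly_between p q r \<noteq> strictly_between p q s"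
proof -
  have sign: "(0 < X \<longleftrightarrow> b) \<and> (X < 0 \<longleftrightarrow> \<not> b)" if "sgn X = (if b then 1 else -1)" for X :: real and b
    using that by (auto simp: sgn_if split: if_splits)
  have side: "sgn (real x - real q) * sgn (real x - real p) = (if strictly_between p q x then -1 else 1)"
    if "x \<noteq> p" "x \<noteq> q" for x
    using that by (auto simp: sgn_if strictly_between_def)
  have "sgn (orient (P p) (P q) (P x)) =
      sgn (real q - real p) * (if strictly_between p q x then -1 else 1)"
    if "x < N" "x \<noteq> p" "x \<noteq> q" for x
    using orient_roots_of_unity[OF assms(1,2) that(1)] side[OF that(2,3)]
    by (simp only: P_def mult.assoc)
  then have "sgn (orient (P p) (P q) (P r) * orient (P p) (P q) (P s)) =
      sgn (real q - real p) * sgn (real q - real p) *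
      (if strictly_between p q r = strictly_between p q s then 1 else -1)"
    using assms(3-5) by (simp add: sgn_mult)
  also have "sgn (real q - real p) * sgn (real q - real p) = 1"
    using assms(5) by (simp add: sgn_if)
  finally have "sgn (orient (P p) (P q) (P r) * orient (P p) (P q) (P s)) =
      (if strictly_between p q r = strictly_between p q s then 1 else -1)"
    by simp
  from sign[OF this] show "orient (P p) (P q) (P r) * orient (P p) (P q) (P s) > 0 \<longleftrightarrow>
      strictly_between p q r = strictly_between p q s"
    and "orient (P p) (P q) (P r) * orient (P p) (P q) (P s) < 0 \<longleftrightarrow>
      strictly_between p q r \<noteq> strictly_between p q s"
    by simp_all
qed

text \<open>Replaces the geometry of chords by the order of positions; all later crossing arguments
  go through this equivalence.\<close>

lemma edges_cross_iff_between:
  assumes \<omega>: "cyclic_order (verts G) \<omega>" and fin: "finite (verts G)"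
    and V: "{u, v, x, y} \<subseteq> verts G" and dist: "distinct [u, v, x, y]"
  shows "edges_cross G \<omega> {u, v} {x, y} \<longleftrightarrow>
    strictly_between (\<omega> u) (\<omega> v) (\<omega> x) \<noteq> strictly_between (\<omega> u) (\<omega> v) (\<omega> y)"
proof -
  define N where "N = card (verts G)"
  define P where "P k = cis (2 * pi * real k / real N)" for k
  have inj: "inj_on \<omega> (verts G)" and lt: "\<And>w. w \<in> verts G \<Longrightarrow> \<omega> w < N"
    using \<omega> by (auto simp: cyclic_order_def bij_betw_def N_def)
  have d: "distinct [\<omega> u, \<omega> v, \<omega> x, \<omega> y]" "distinct [\<omega> x, \<omega> y, \<omega> u, \<omega> v]"
    using dist V by (auto simp: inj_on_eq_iff[OF inj])
  have lts: "\<omega> u < N" "\<omega> v < N" "\<omega> x < N" "\<omega> y < N"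
    using V lt by auto
  note sides = orient_mult_roots_of_unity[OF lts d(1), folded P_def]
    orient_mult_roots_of_unity[OF lts(3,4,1,2) d(2), folded P_def]
  have point: "point G \<omega> w = P (\<omega> w)" for w
    by (simp add: point_def P_def N_def)
  have chord: "chord G \<omega> {v, w} = closed_segment (P (\<omega> v)) (P (\<omega> w))" for v w
    by (simp add: chord_def point segment_convex_hull)
  show ?thesis
  proof (cases "strictly_between (\<omega> u) (\<omega> v) (\<omega> x) = strictly_between (\<omega> u) (\<omega> v) (\<omega> y)")
    case True
    then have "chord G \<omega> {u, v} \<inter> chord G \<omega> {x, y} = {}"
      unfolding chord by (intro segments_disjoint_same_side) (simp only: sides(1))
    with True show ?thesis
      by (simp add: edges_cross_def)
  next
    case False
    then have "orient (P (\<omega> u)) (P (\<omega> v)) (P (\<omega> x)) * orient (P (\<omega> u)) (P (\<omega> v)) (P (\<omega> y)) < 0"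
      "orient (P (\<omega> x)) (P (\<omega> y)) (P (\<omega> u)) * orient (P (\<omega> x)) (P (\<omega> y)) (P (\<omega> v)) < 0"
      unfolding sides(2,4) using strictly_between_swap[OF _ d(1)] by simp_all
    then obtain z where "z \<in> closed_segment (P (\<omega> u)) (P (\<omega> v))"
      "z \<in> closed_segment (P (\<omega> x)) (P (\<omega> y))"
      "z \<notin> {P (\<omega> u), P (\<omega> v), P (\<omega> x), P (\<omega> y)}"
      by (rule segments_cross_opposite_sides)
    then have "edges_cross G \<omega> {u, v} {x, y}"
      unfolding edges_cross_def chord by (intro bexI[of _ z]) (simp_all add: point)
    with False show ?thesis
      by blast
  qed
qed

section \<open>Dispersable embeddings\<close>

declare One_nat_def [simp del] add_2_eq_Suc [simp del] add_2_eq_Suc' [simp del]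

lemma finite_edges:
  assumes "simple_graph G"
  shows "finite (edges G)"
  using assms by (intro finite_subset[of "edges G" "Pow (verts G)"]) (auto simp: simple_graph_def)

lemma inj_on_incident_edges:
  assumes "matching_book_embedding G \<omega> c"
  shows "inj_on c {e \<in> edges G. w \<in> e}"
proof (rule inj_onI, rule ccontr)
  fix e f
  assume "e \<in> {e \<in> edges G. w \<in> e}" "f \<in> {e \<in> edges G. w \<in> e}" "c e = c f" "e \<noteq> f"
  moreover from this have "e \<inter> f = {}"
    using assms by (simp add: matching_book_embedding_def)
  ultimately show False
    by auto
qed

lemma degree_le_num_colors:
  assumes "matching_book_embedding G \<omega> c"
  shows "degree G w \<le> num_colors G c"
proof -
  have "finite (edges G)"
    using assms by (simp add: matching_book_embedding_def finite_edges)
  then have "card (c ` {e \<in> edges G. w \<in> e}) \<le> card (c ` edges G)"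
    by (intro card_mono image_mono) auto
  then show ?thesis
    by (simp add: degree_def num_colors_def card_image[OF inj_on_incident_edges[OF assms]])
qed

text \<open>When every degree equals the number of colors, every color occurs at every vertex. The
  page of \<open>{u, v}\<close> therefore matches the vertices between its ends among themselves, so
  their number is even.\<close>

lemma odd_position_sum_of_edge:
  assumes emb: "matching_book_embedding G \<omega> c"
    and deg: "\<And>w. w \<in> verts G \<Longrightarrow> degree G w = num_colors G c"
    and e: "{u, v} \<in> edges G"
  shows "odd (\<omega> u + \<omega> v)"
proof -
  have simple: "simple_graph G" and cyc: "cyclic_order (verts G) \<omega>"
    and page: "\<And>f g. f \<in> edges G \<Longrightarrow> g \<in> edges G \<Longrightarrow> f \<noteq> g \<Longrightarrow> c f = c g \<Longrightarrow>
      \<not> edges_cross G \<omega> f g \<and> f \<inter> g = {}"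
    using emb by (auto simp: matching_book_embedding_def)
  have fin: "finite (verts G)" and edge: "\<And>f. f \<in> edges G \<Longrightarrow> f \<subseteq> verts G \<and> card f = 2"
    using simple by (auto simp: simple_graph_def)
  have finE: "finite (edges G)"
    using simple by (rule finite_edges)
  have inj: "inj_on \<omega> (verts G)" and img: "\<omega> ` verts G = {0..<card (verts G)}"
    using cyc by (auto simp: cyclic_order_def bij_betw_def)
  have uv: "u \<in> verts G" "v \<in> verts G" "u \<noteq> v"
    using edge[OF e] by auto
  define M where "M = {w \<in> verts G. strictly_between (\<omega> u) (\<omega> v) (\<omega> w)}"
  define C where "C = {f \<in> edges G. c f = c {u, v} \<and> f \<subseteq> M}"
  have M: "M \<subseteq> verts G" "u \<notin> M" "v \<notin> M"
    by (auto simp: M_def strictly_between_def)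
  have perfect: "\<exists>f\<in>edges G. w \<in> f \<and> c f = c {u, v}" if "w \<in> verts G" for w
  proof -
    have "card (c ` {f \<in> edges G. w \<in> f}) = card (c ` edges G)"
      using card_image[OF inj_on_incident_edges[OF emb, of w]] deg[OF that]
      by (simp add: degree_def num_colors_def)
    \<comment> \<open>The edges at \<open>w\<close> have distinct colors and are as many as all
      colors, so no color is missing at \<open>w\<close>.\<close>
    then have "c ` {f \<in> edges G. w \<in> f} = c ` edges G"
      using finE by (intro card_subset_eq) auto
    then have "c {u, v} \<in> c ` {f \<in> edges G. w \<in> f}"
      using e by simp
    then show ?thesis by force
  qed
  have "\<Union> C = M"
  proof
    show "\<Union> C \<subseteq> M"
      by (auto simp: C_def)
    show "M \<subseteq> \<Union> C"
    proof
      fix w assume w: "w \<in> M"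
      with M perfect obtain f where f: "f \<in> edges G" "w \<in> f" "c f = c {u, v}"
        by blast
      with w M have "f \<noteq> {u, v}"
        by auto
      with f page[OF f(1) e] page[OF e f(1)]
      have disj: "f \<inter> {u, v} = {}" and nc: "\<not> edges_cross G \<omega> {u, v} f"
        by auto
      obtain x where x: "f = {w, x}" "w \<noteq> x"
        using edge[OF f(1)] f(2) by (auto simp: card_2_iff)
      have V: "{u, v, w, x} \<subseteq> verts G"
        using uv x edge[OF f(1)] by auto
      have "distinct [u, v, w, x]"
        using uv x disj by auto
      \<comment> \<open>Not crossing \<open>{u, v}\<close> forces the partner \<open>x\<close> of
        \<open>w\<close> onto the same side.\<close>
      from edges_cross_iff_between[OF cyc fin V this] nc x w
      have "f \<subseteq> M"
        using V by (auto simp: M_def)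
      with f show "w \<in> \<Union> C"
        by (auto simp: C_def)
    qed
  qed
  moreover have "finite C" "finite M"
    using finE fin M finite_subset by (auto simp: C_def)
  moreover have "\<And>f. f \<in> C \<Longrightarrow> card f = 2"
    using edge by (auto simp: C_def)
  moreover have "\<And>f g. f \<in> C \<Longrightarrow> g \<in> C \<Longrightarrow> f \<noteq> g \<Longrightarrow> f \<inter> g = {}"
    using page by (auto simp: C_def)
  ultimately have "2 * card C = card M"
    using card_partition[of C 2] by simp
  \<comment> \<open>Every position is occupied, so the size of \<open>M\<close> is the gap between
    the two positions minus 1.\<close>
  moreover have "\<omega> ` M = {min (\<omega> u) (\<omega> v)<..<max (\<omega> u) (\<omega> v)}"
  proof
    show "\<omega> ` M \<subseteq> {min (\<omega> u) (\<omega> v)<..<max (\<omega> u) (\<omega> v)}"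
      by (auto simp: M_def strictly_between_def)
    show "{min (\<omega> u) (\<omega> v)<..<max (\<omega> u) (\<omega> v)} \<subseteq> \<omega> ` M"
    proof
      fix k assume k: "k \<in> {min (\<omega> u) (\<omega> v)<..<max (\<omega> u) (\<omega> v)}"
      have "\<omega> u < card (verts G)" "\<omega> v < card (verts G)"
        using uv(1,2)[THEN imageI, of \<omega>] unfolding img by simp_all
      with k have "k \<in> \<omega> ` verts G"
        unfolding img by auto
      with k show "k \<in> \<omega> ` M"
        by (auto simp: M_def strictly_between_def min_def max_def split: if_splits)
    qed
  qed
  then have "card M = max (\<omega> u) (\<omega> v) - Suc (min (\<omega> u) (\<omega> v))"
    using card_image[OF inj_on_subset[OF inj M(1)]] by simp
  moreover have "\<omega> u \<noteq> \<omega> v"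
    using uv inj by (auto simp: inj_on_def)
  ultimately have "\<omega> u = Suc (\<omega> v + 2 * card C) \<or> \<omega> v = Suc (\<omega> u + 2 * card C)"
    by (cases "\<omega> u < \<omega> v") simp_all
  then show ?thesis
    by (elim disjE) simp_all
qed

section \<open>The circulant\<close>

text \<open>Indices run from 0 so that \<open>mod n\<close> yields an index directly;
  \<open>Suc\<close> translates to the vertex set \<open>{1..n}\<close>.\<close>

definition shift_edge :: "nat \<Rightarrow> nat \<Rightarrow> nat \<Rightarrow> nat set" where
  "shift_edge n i s = {Suc i, Suc ((i + s) mod n)}"

lemma edges_circulant:
  assumes "n > 0"
  shows "edges (circulant n S) = {shift_edge n i s |i s. i < n \<and> s \<in> S}"
proof (intro subset_antisym subsetI)
  fix e assume "e \<in> edges (circulant n S)"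
  then obtain j k s where jk: "e = {j, k}" "j \<in> {1..n}" "k \<in> {1..n}" "s \<in> S" "[k = j + s] (mod n)"
    by (auto simp: circulant_def)
  define i k' where "i = j - 1" and "k' = k - 1"
  have j: "j = Suc i" "i < n" and k: "k = Suc k'" "k' < n"
    using jk by (auto simp: i_def k'_def)
  have "[1 + k' = 1 + (i + s)] (mod n)"
    using jk(5) j k by (simp only: Suc_eq_plus1_left add.assoc)
  then have "[k' = i + s] (mod n)"
    by (simp only: cong_add_lcancel_nat)
  then have "k' = (i + s) mod n"
    using k by (simp add: cong_def)
  then have "e = shift_edge n i s"
    using jk(1) j(1) k(1) by (simp add: shift_edge_def)
  then show "e \<in> {shift_edge n i s |i s. i < n \<and> s \<in> S}"
    using j(2) jk(4) by blast
next
  fix e assume "e \<in> {shift_edge n i s |i s. i < n \<and> s \<in> S}"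
  then obtain i s where is': "e = shift_edge n i s" "i < n" "s \<in> S"
    by auto
  have "[1 + (i + s) mod n = 1 + (i + s)] (mod n)"
    by (simp only: cong_add_lcancel_nat) simp
  then have "[Suc ((i + s) mod n) = Suc i + s] (mod n)"
    by (simp only: Suc_eq_plus1_left add.assoc)
  moreover have "Suc ((i + s) mod n) \<in> {1..n}" "Suc i \<in> {1..n}"
    using assms is' by (auto simp: Suc_le_eq)
  ultimately show "e \<in> edges (circulant n S)"
    unfolding circulant_def snd_conv mem_Collect_eq is'(1) shift_edge_def using is'(3)
    by (intro exI[of _ "Suc i"] exI[of _ "Suc ((i + s) mod n)"]) auto
qed

section \<open>Degrees for the jumps 1 and 2, and non-dispersability\<close>

lemma mod_add_wrap:
  assumes "i < n" "s \<le> (n :: nat)"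
  shows "(i + s) mod n = (if i + s < n then i + s else i + s - n)"
  using assms by (simp add: mod_if)

lemma degree_circulant_1_2:
  assumes "n \<ge> 5" "w \<in> verts (circulant n {1, 2})"
  shows "degree (circulant n {1, 2}) w = 4"
proof -
  define i where "i = w - 1"
  have w: "w = Suc i" "i < n"
    using assms by (auto simp: i_def circulant_def)
  \<comment> \<open>Indices of the neighbours; the backward jumps by 1 and 2 are written as forward
    jumps by \<open>n - 1\<close> and \<open>n - 2\<close>. The four offsets are distinct since
    \<open>n\<close> is at least 5.\<close>
  define nb where "nb = (\<lambda>d. (i + d) mod n) ` {1, 2, n - 1, n - 2}"
  have nb_iff: "(j + s) mod n = i \<longleftrightarrow> j = (i + (n - s)) mod n" if "j < n" "s \<in> {1, 2}" for j s
  proof -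
    have "s \<le> n"
      using that assms by auto
    from mod_add_wrap[OF that(1) this] mod_add_wrap[OF w(2) diff_le_self[of n s]]
    show ?thesis
      using that(1) w(2) \<open>s \<le> n\<close> by auto
  qed
  have "{e \<in> edges (circulant n {1, 2}). w \<in> e} = (\<lambda>j. {Suc i, Suc j}) ` nb"
  proof (intro subset_antisym subsetI)
    fix e assume "e \<in> {e \<in> edges (circulant n {1, 2}). w \<in> e}"
    then obtain j s where js: "e = shift_edge n j s" "j < n" "s \<in> {1, 2}" "w \<in> e"
      using assms by (auto simp: edges_circulant)
    then consider "j = i" | "(j + s) mod n = i"
      using w by (auto simp: shift_edge_def)
    then show "e \<in> (\<lambda>j. {Suc i, Suc j}) ` nb"
    proof cases
      case 1
      then show ?thesis using js by (auto simp: nb_def shift_edge_def)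
    next
      case 2
      then have "e = {Suc i, Suc j}" "j \<in> nb"
        using js nb_iff[of j s] by (auto simp: shift_edge_def nb_def)
      then show ?thesis by blast
    qed
  next
    fix e assume "e \<in> (\<lambda>j. {Suc i, Suc j}) ` nb"
    then obtain j where j: "e = {Suc i, Suc j}" "j \<in> nb"
      by blast
    then obtain s where s: "s \<in> {1, 2}" "j = (i + s) mod n \<or> j = (i + (n - s)) mod n"
      by (auto simp: nb_def)
    have "j < n"
      using s w by auto
    then have "e = shift_edge n i s \<or> e = shift_edge n j s"
      using s j nb_iff[of j s] by (auto simp: shift_edge_def)
    then show "e \<in> {e \<in> edges (circulant n {1, 2}). w \<in> e}"
      using s w j \<open>j < n\<close> assms by (auto simp: edges_circulant)
  qed
  moreover have "inj_on (\<lambda>j. {Suc i, Suc j}) nb"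
    by (auto simp: inj_on_def doubleton_eq_iff)
  moreover have "card nb = 4"
  proof -
    have "d = d'" if "d < n" "d' < n" "(i + d) mod n = (i + d') mod n" for d d'
      using that cong_add_lcancel_nat[of i d d' n] by (simp add: cong_def)
    then have "inj_on (\<lambda>d. (i + d) mod n) {..<n}"
      unfolding inj_on_def by blast
    then have "inj_on (\<lambda>d. (i + d) mod n) {1, 2, n - 1, n - 2}"
      by (rule inj_on_subset) (use assms in auto)
    moreover obtain m where "n = m + 5"
      using assms(1) by (metis add.commute le_Suc_ex)
    then have "card {1, 2, n - 1, n - 2} = 4"
      by (simp add: card_insert_if)
    ultimately show ?thesis
      by (simp only: nb_def card_image)
  qed
  ultimately show ?thesis
    unfolding degree_def by (simp only: card_image)
qed

lemma max_degree_circulant_1_2: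
  assumes "n \<ge> 5"
  shows "max_degree (circulant n {1, 2}) = 4"
proof -
  let ?G = "circulant n {1, 2}"
  have "degree ?G ` verts ?G = (\<lambda>_. 4) ` verts ?G"
    by (intro image_cong refl degree_circulant_1_2[OF assms])
  moreover have "verts ?G \<noteq> {}"
    using assms by (simp add: circulant_def)
  ultimately show ?thesis
    unfolding max_degree_def by (simp only: image_constant_conv if_False Max_singleton)
qed

lemma not_dispersable_circulant_1_2:
  assumes "n \<ge> 5"
  shows "\<not> dispersable (circulant n {1, 2})"
proof
  let ?G = "circulant n {1, 2}"
  assume "dispersable ?G"
  then obtain \<omega> c where emb: "matching_book_embedding ?G \<omega> c" and num: "num_colors ?G c = 4"
    using assms by (auto simp: dispersable_def max_degree_circulant_1_2)
  have deg: "degree ?G w = num_colors ?G c" if "w \<in> verts ?G" for w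
    using degree_circulant_1_2[OF assms that] num by simp
  have "shift_edge n i s \<in> edges ?G" if "i < n" "s \<in> {1, 2}" for i s
    using that edges_circulant[of n "{1, 2}"] assms by blast
  from this[of 0 1] this[of 1 1] this[of 0 2]
  have "shift_edge n 0 1 \<in> edges ?G" "shift_edge n 1 1 \<in> edges ?G" "shift_edge n 0 2 \<in> edges ?G"
    using assms by simp_all
  then have "{1, 2} \<in> edges ?G" "{2, 3} \<in> edges ?G" "{1, 3} \<in> edges ?G"
    using assms by (simp_all add: shift_edge_def flip: One_nat_def)
  then have "odd (\<omega> 1 + \<omega> 2)" "odd (\<omega> 2 + \<omega> 3)" "odd (\<omega> 1 + \<omega> 3)"
    using odd_position_sum_of_edge[OF emb deg] by blast+
  \<comment> \<open>The three sums add up to an even number, so they cannot all be odd.\<close>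
  then show False by presburger
qed

text \<open>Reduces an embedding to a condition on index pairs \<open>(i, s)\<close>. Each edge
  takes the color of one chosen pair, and distinct edges have distinct pairs, so \<open>page\<close>
  applies to them.\<close>

lemma circulant_1_2_embedding:
  fixes col :: "nat \<Rightarrow> nat \<Rightarrow> nat"
  assumes n: "n \<ge> 5" and \<pi>: "bij_betw \<pi> {0..<n} {0..<n}"
    and page: "\<And>i s j t. i < n \<Longrightarrow> j < n \<Longrightarrow> s \<in> {1, 2} \<Longrightarrow> t \<in> {1, 2} \<Longrightarrow> (i, s) \<noteq> (j, t) \<Longrightarrow>
      col i s = col j t \<Longrightarrow>
      {i, (i + s) mod n} \<inter> {j, (j + t) mod n} = {} \<and>
      strictly_between (\<pi> i) (\<pi> ((i + s) mod n)) (\<pi> j) = strictly_between (\<pi> i) (\<pi> ((i + s) mod n)) (\<pi> ((j + t) mod n))"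
  shows "\<exists>\<omega> c. matching_book_embedding (circulant n {1, 2}) \<omega> c \<and>
    c ` edges (circulant n {1, 2}) \<subseteq> {col i s |i s. i < n \<and> s \<in> {1, 2}}"
proof -
  let ?G = "circulant n {1, 2}"
  define \<omega> where "\<omega> = (\<lambda>v. \<pi> (v - 1))"
  define idx where "idx = (\<lambda>e. SOME (i, s). i < n \<and> s \<in> {1, 2} \<and> e = shift_edge n i s)"
  define c where "c = (\<lambda>e. case idx e of (i, s) \<Rightarrow> col i s)"
  have V: "verts ?G = {1..n}"
    by (simp add: circulant_def)
  have simple: "simple_graph ?G"
    using n by (intro simple_graph_circulant) auto
  have idx: "\<exists>i s. idx e = (i, s) \<and> i < n \<and> s \<in> {1, 2} \<and> e = shift_edge n i s"
    if "e \<in> edges ?G" for e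
  proof -
    have "\<exists>p. case p of (i, s) \<Rightarrow> i < n \<and> s \<in> {1, 2} \<and> e = shift_edge n i s"
      using that n by (auto simp: edges_circulant)
    from someI_ex[OF this] show ?thesis
      unfolding idx_def by (auto split: prod.splits)
  qed
  have "bij_betw (\<lambda>v. v - 1) {1..n} {0..<n}"
    by (rule bij_betwI[where g = Suc]) auto
  then have cyc: "cyclic_order (verts ?G) \<omega>"
    unfolding cyclic_order_def V \<omega>_def using bij_betw_trans[OF _ \<pi>]
    by (simp add: o_def)
  have "\<not> edges_cross ?G \<omega> e f \<and> e \<inter> f = {}"
    if ef: "e \<in> edges ?G" "f \<in> edges ?G" "e \<noteq> f" "c e = c f" for e f
  proof -
    obtain i s where is': "idx e = (i, s)" "i < n" "s \<in> {1, 2}" "e = shift_edge n i s"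
      using idx ef by blast
    obtain j t where jt: "idx f = (j, t)" "j < n" "t \<in> {1, 2}" "f = shift_edge n j t"
      using idx ef by blast
    have "(i, s) \<noteq> (j, t)" "col i s = col j t"
      using ef is' jt by (auto simp: c_def)
    note * = page[OF is'(2) jt(2) is'(3) jt(3) this]
    have "e \<subseteq> verts ?G" "f \<subseteq> verts ?G" "card e = 2" "card f = 2"
      using simple ef by (auto simp: simple_graph_def)
    then have sub: "{Suc i, Suc ((i + s) mod n), Suc j, Suc ((j + t) mod n)} \<subseteq> verts ?G"
      and ne: "i \<noteq> (i + s) mod n" "j \<noteq> (j + t) mod n"
      using is'(4) jt(4) by (auto simp: shift_edge_def)
    have "distinct [Suc i, Suc ((i + s) mod n), Suc j, Suc ((j + t) mod n)]"
      using ne * by auto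
    from edges_cross_iff_between[OF cyc _ sub this] show ?thesis
      using * is'(4) jt(4) V by (auto simp: shift_edge_def \<omega>_def)
  qed
  then have "matching_book_embedding ?G \<omega> c"
    using simple cyc by (auto simp: matching_book_embedding_def)
  moreover have "c ` edges ?G \<subseteq> {col i s |i s. i < n \<and> s \<in> {1, 2}}"
  proof
    fix k assume "k \<in> c ` edges ?G"
    then obtain e where "e \<in> edges ?G" "k = c e"
      by blast
    with idx[of e] show "k \<in> {col i s |i s. i < n \<and> s \<in> {1, 2}}"
      unfolding c_def by (metis (mono_tags, lifting) case_prod_conv mem_Collect_eq)
  qed
  ultimately show ?thesis by blast
qed

section \<open>Page assignments\<close>

text \<open>Entry \<open>i\<close> of a list holds the pages of \<open>{i, i + 1}\<close> and \<open>{i, i + 2}\<close>, in this order.\<close>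

definition window :: "nat \<times> nat \<Rightarrow> nat \<times> nat \<Rightarrow> nat \<times> nat \<Rightarrow> bool" where
  "window x y z \<longleftrightarrow> distinct [fst x, snd x, fst y, snd y] \<and> snd x \<noteq> fst z \<and> snd x \<noteq> snd z"

fun all_windows :: "(nat \<times> nat) list \<Rightarrow> bool" where
  "all_windows (x # y # z # zs) \<longleftrightarrow> window x y z \<and> all_windows (y # z # zs)"
| "all_windows _ \<longleftrightarrow> True"

lemma all_windows_nth:
  "all_windows xs \<Longrightarrow> i + 2 < length xs \<Longrightarrow> window (xs ! i) (xs ! (i + 1)) (xs ! (i + 2))"
proof (induction xs arbitrary: i rule: all_windows.induct)
  case (1 x y z zs)
  then show ?case by (cases i) auto
qed auto

text \<open>A window that starts in \<open>xs\<close> reaches at most two entries into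
  \<open>ys\<close>.\<close>

lemma all_windows_append:
  "all_windows (xs @ take 2 ys) \<Longrightarrow> all_windows ys \<Longrightarrow> length ys \<ge> 2 \<Longrightarrow> all_windows (xs @ ys)"
proof (induction xs rule: all_windows.induct)
  case ("2_2" x)
  then show ?case by (cases ys rule: all_windows.cases) auto
next
  case ("2_3" x y)
  then show ?case by (cases ys rule: all_windows.cases) auto
qed auto

lemma all_windows_repeat:
  assumes "all_windows (B @ take 2 B)" "all_windows (B @ take 2 zs)" "all_windows zs"
    "length B \<ge> 2" "length zs \<ge> 2"
  shows "all_windows (concat (replicate k B) @ zs)"
proof (induction k)
  case (Suc k)
  \<comment> \<open>Whatever follows a copy of \<open>B\<close> begins like \<open>B\<close> or like
    \<open>zs\<close>, so only two kinds of joint occur.\<close>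
  have "take 2 (concat (replicate k B) @ zs) \<in> {take 2 B, take 2 zs}"
    using assms by (cases k) auto
  then show ?case
    using Suc assms all_windows_append[of B "concat (replicate k B) @ zs"] by auto
qed (use assms in simp)

text \<open>Appending the first two entries makes the linear check cover the windows that close the
  cycle.\<close>

lemma cyclic_coloring_exists:
  assumes "n \<ge> 5" "n \<noteq> 7"
  shows "\<exists>xs. length xs = n \<and> set xs \<subseteq> {..<5} \<times> {..<5} \<and> all_windows (xs @ take 2 xs)"
proof -
  \<comment> \<open>The words are chosen so that, read cyclically, each leaves the five tilings in the same
    state as \<open>B\<close>, so that they may be appended to copies of \<open>B\<close>.\<close>
  define B :: "(nat \<times> nat) list" where "B = [(0,2),(4,1),(3,0),(2,4),(1,3)]"
  \<comment> \<open>One word \<open>L\<close> with the residue of \<open>n\<close> modulo 5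
    suffices: copies of \<open>B\<close> in front of it fill the remaining length.\<close>
  have ex: ?thesis
    if L: "length L \<le> n" "length L mod 5 = n mod 5" "length L \<ge> 2" "set L \<subseteq> {..<5} \<times> {..<5}"
      "all_windows (L @ take 2 L)" "all_windows (L @ take 2 B)" "all_windows (B @ take 2 L)" for L
  proof -
    obtain k where k: "n = 5 * k + length L"
      using L(1,2) by (metis add.commute mod_eq_nat2E)
    define xs where "xs = concat (replicate k B) @ L"
    have "all_windows (L @ take 2 xs)"
      using L by (cases k) (auto simp: xs_def B_def)
    then have "all_windows (concat (replicate k B) @ (L @ take 2 xs))"
      using L by (intro all_windows_repeat) (auto simp: B_def window_def)
    moreover have "length xs = n"
      using k by (simp add: xs_def B_def length_concat sum_list_replicate)
    moreover have "set B \<subseteq> {..<5} \<times> {..<5}"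
      by (simp add: B_def)
    then have "set xs \<subseteq> {..<5} \<times> {..<5}"
      using L(4) by (cases "k = 0") (simp_all add: xs_def)
    moreover have "all_windows (xs @ take 2 xs)"
      using calculation(1) by (simp add: xs_def)
    ultimately show ?thesis
      by blast
  qed
  define L6 L8 L9 L12 :: "(nat \<times> nat) list"
    where "L6 = [(0,2),(1,4),(0,3),(1,2),(0,4),(1,3)]"
      and "L8 = [(0,2),(4,1),(0,3),(2,4),(0,1),(3,2),(0,4),(1,3)]"
      and "L9 = [(0,2),(4,1),(0,3),(4,2),(1,0),(4,3),(1,2),(0,4),(1,3)]"
      and "L12 = L6 @ L6"
  note defs = B_def L6_def L8_def L9_def L12_def window_def
  define q r where "q = n div 5" and "r = n mod 5"
  have n: "n = 5 * q + r" "r < 5"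
    by (simp_all add: q_def r_def)
  \<comment> \<open>The excluded value 7 is \<open>r = 2\<close> with \<open>q = 1\<close>; so
    residue 2 starts at 12, where two copies of \<open>L6\<close> fit.\<close>
  then have "q \<ge> 1" "r = 2 \<Longrightarrow> q \<noteq> 1"
    using assms by auto
  moreover have "r = 0 \<or> r = 1 \<or> r = 2 \<or> r = 3 \<or> r = 4"
    using n(2) by linarith
  ultimately have "r = 0 \<or> r = 1 \<and> n \<ge> 6 \<or> r = 2 \<and> n \<ge> 12 \<or> r = 3 \<and> n \<ge> 8 \<or> r = 4 \<and> n \<ge> 9"
    using n(1) by linarith
  then show ?thesis
    unfolding r_def
  proof (elim disjE conjE)
    assume "n mod 5 = 0"
    then show ?thesis
      using assms by (intro ex[of B]) (simp_all add: defs)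
  next
    assume "n mod 5 = 1" "n \<ge> 6"
    then show ?thesis
      by (intro ex[of L6]) (simp_all add: defs)
  next
    assume "n mod 5 = 2" "n \<ge> 12"
    then show ?thesis
      by (intro ex[of L12]) (simp_all add: defs)
  next
    assume "n mod 5 = 3" "n \<ge> 8"
    then show ?thesis
      by (intro ex[of L8]) (simp_all add: defs)
  next
    assume "n mod 5 = 4" "n \<ge> 9"
    then show ?thesis
      by (intro ex[of L9]) (simp_all add: defs)
  qed
qed

text \<open>The inequalities make the two blocks disjoint on the cycle, so the second edge lies
  entirely on one side of the first.\<close>

lemma natural_order_page:
  assumes "i < n" "j < n" "s \<in> {1, 2}" "t \<in> {1, 2}" "n \<ge> 5" "i \<noteq> j"
    "j \<noteq> (i + 1) mod n" "i \<noteq> (j + 1) mod n"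
    "s = 2 \<Longrightarrow> j \<noteq> (i + 2) mod n" "t = 2 \<Longrightarrow> i \<noteq> (j + 2) mod n"
  shows "{i, (i + s) mod n} \<inter> {j, (j + t) mod n} = {} \<and>
    strictly_between i ((i + s) mod n) j = strictly_between i ((i + s) mod n) ((j + t) mod n)"
proof -
  define k l where "k = (i + s) mod n" and "l = (j + t) mod n"
  have k: "k = i + s \<and> i + s < n \<or> k + n = i + s" and l: "l = j + t \<and> j + t < n \<or> l + n = j + t"
    unfolding k_def l_def using assms(1-5) mod_add_wrap[of i n s] mod_add_wrap[of j n t]
    by (auto split: if_splits)
  have s: "s = 1 \<or> s = 2" and t: "t = 1 \<or> t = 2"
    using assms(3,4) by auto
  have "i + 1 \<noteq> j" "j + 1 \<noteq> i" "i + 1 \<noteq> j + n" "j + 1 \<noteq> i + n"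
    using assms(1,2,5,7,8) mod_add_wrap[of i n 1] mod_add_wrap[of j n 1] by auto
  moreover have "s = 2 \<Longrightarrow> i + 2 \<noteq> j \<and> i + 2 \<noteq> j + n" "t = 2 \<Longrightarrow> j + 2 \<noteq> i \<and> j + 2 \<noteq> i + n"
    using assms(1,2,5,9,10) mod_add_wrap[of i n 2] mod_add_wrap[of j n 2] by auto
  ultimately have ne: "i + 1 \<noteq> j" "j + 1 \<noteq> i" "i + 1 \<noteq> j + n" "j + 1 \<noteq> i + n"
    "s = 2 \<Longrightarrow> i + 2 \<noteq> j \<and> i + 2 \<noteq> j + n" "t = 2 \<Longrightarrow> j + 2 \<noteq> i \<and> j + 2 \<noteq> i + n"
    by blast+
  have jk: "j \<noteq> k"
    using k s ne by auto
  have il: "i \<noteq> l"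
    using l t ne by auto
  have kl: "k \<noteq> l"
    using k l s t ne assms(1,2,6) by (elim disjE conjE) simp_all
  \<comment> \<open>An edge that wraps past \<open>n\<close> has all vertices outside its block
    between its ends; any other edge has none of them.\<close>
  have inside: "strictly_between i k x \<longleftrightarrow> k < i"
    if "x < n" "x \<noteq> i" "x \<noteq> k" "x \<noteq> i + 1" "x + n \<noteq> i + 1" for x
    using k s that assms(1,5) unfolding strictly_between_def by (elim disjE conjE) auto
  have "strictly_between i k j \<longleftrightarrow> k < i"
    using ne jk assms(2,6) by (intro inside) auto
  moreover have "strictly_between i k l \<longleftrightarrow> k < i"
  proof (rule inside)
    show "l < n"
      using assms(2) by (simp add: l_def)
    show "l \<noteq> i + 1"
      using l t ne(1-4) assms(1,2,6) by auto
    show "l + n \<noteq> i + 1"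
      using l t ne(1-4) assms(1,2,6) by auto
  qed (use il kl in auto)
  ultimately show ?thesis
    using assms(6) jk il kl unfolding k_def l_def by auto
qed

section \<open>The exceptional case of seven vertices\<close>

definition order7 :: "nat \<Rightarrow> nat" where
  "order7 = id(5 := 6, 6 := 5)"

text \<open>Exchanging vertices 5 and 6 lets pages 3 and 4 carry three long edges each,
  \<open>{0,2}\<close>, \<open>{3,5}\<close>, \<open>{4,6}\<close> and \<open>{2,4}\<close>,
  \<open>{5,0}\<close>, \<open>{6,1}\<close>, with nested chords. The last long edge
  \<open>{1,3}\<close> joins \<open>{6,0}\<close> on page 2.\<close>

definition color7 :: "nat \<Rightarrow> nat \<Rightarrow> nat" where
  "color7 i s = (if s = 1 then if i = 6 then 2 else i mod 2
    else ((\<lambda>_. 3)(1 := 2, 2 := 4, 5 := 4, 6 := 4)) i)"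

lemma less_7_iff: "i < 7 \<longleftrightarrow> i \<in> {0, 1, 2, 3, 4, 5, 6}" for i :: nat
  by auto

lemma order7_page:
  assumes "i < 7" "j < 7" "s \<in> {1, 2}" "t \<in> {1, 2}" "(i, s) \<noteq> (j, t)"
    "color7 i s = color7 j t"
  shows "{i, (i + s) mod 7} \<inter> {j, (j + t) mod 7} = {} \<and>
    strictly_between (order7 i) (order7 ((i + s) mod 7)) (order7 j) =
    strictly_between (order7 i) (order7 ((i + s) mod 7)) (order7 ((j + t) mod 7))"
  using assms unfolding less_7_iff
  apply (elim insertE emptyE; simp add: color7_def)
  apply (simp_all add: order7_def strictly_between_def)
  done

lemma circulant_1_2_five_pages:
  assumes "n \<ge> 5"
  shows "\<exists>\<omega> c. matching_book_embedding (circulant n {1, 2}) \<omega> c \<and>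
    c ` edges (circulant n {1, 2}) \<subseteq> {..<5}"
proof (cases "n = 7")
  case True
  have bij: "bij_betw order7 {0..<7} {0..<7}"
    by (rule bij_betwI[where g = order7]) (auto simp: order7_def)
  have "\<exists>\<omega> c. matching_book_embedding (circulant 7 {1, 2}) \<omega> c \<and>
    c ` edges (circulant 7 {1, 2}) \<subseteq> {color7 i s |i s. i < 7 \<and> s \<in> {1, 2}}"
    by (rule circulant_1_2_embedding[OF _ bij order7_page]) simp_all
  moreover have "color7 i s < 5" for i s
    using less_trans[OF mod_less_divisor[of 2 i], of 5] by (simp add: color7_def)
  then have "{color7 i s |i s. i < 7 \<and> s \<in> {1, 2}} \<subseteq> {..<5}"
    by auto
  ultimately show ?thesis
    unfolding True by (meson subset_trans)
next
  case False
  then obtain xs where len: "length xs = n" and set: "set xs \<subseteq> {..<5} \<times> {..<5}"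
    and win: "all_windows (xs @ take 2 xs)"
    using cyclic_coloring_exists assms by blast
  have wrap: "(xs @ take 2 xs) ! (i + d) = xs ! ((i + d) mod n)" if "i < n" "d \<le> 2" for i d
    using that len assms by (auto simp: nth_append mod_add_wrap)
  have window: "window (xs ! i) (xs ! ((i + 1) mod n)) (xs ! ((i + 2) mod n))" if "i < n" for i
    using all_windows_nth[OF win, of i] wrap[OF that, of 0] wrap[OF that, of 1] wrap[OF that, of 2]
      that len assms by simp
  define a b where "a = (\<lambda>i. fst (xs ! i))" and "b = (\<lambda>i. snd (xs ! i))"
  define col where "col = (\<lambda>i s. if s = (1::nat) then a i else b i)"
  have ne: "a i \<noteq> b i" "a i \<noteq> a ((i + 1) mod n)" "a i \<noteq> b ((i + 1) mod n)" "b i \<noteq> a ((i + 1) mod n)"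
    "b i \<noteq> b ((i + 1) mod n)" "b i \<noteq> a ((i + 2) mod n)" "b i \<noteq> b ((i + 2) mod n)" if "i < n" for i
    using window[OF that] by (auto simp: window_def a_def b_def)
  have "\<exists>\<omega> c. matching_book_embedding (circulant n {1, 2}) \<omega> c \<and>
    c ` edges (circulant n {1, 2}) \<subseteq> {col i s |i s. i < n \<and> s \<in> {1, 2}}"
  proof (rule circulant_1_2_embedding[where \<pi> = "\<lambda>i. i"])
    fix i s j t :: nat
    assume *: "i < n" "j < n" "s \<in> {1, 2}" "t \<in> {1, 2}" "(i, s) \<noteq> (j, t)" "col i s = col j t"
    show "{i, (i + s) mod n} \<inter> {j, (j + t) mod n} = {} \<and>
      strictly_between i ((i + s) mod n) j = strictly_between i ((i + s) mod n) ((j + t) mod n)"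
    \<comment> \<open>Any overlap of the two blocks would contradict one of the color inequalities
      \<open>ne\<close>, read from \<open>i\<close> or from \<open>j\<close>.\<close>
    proof (rule natural_order_page[OF *(1-4) assms])
      show "i \<noteq> j"
        using * ne(1)[of i] by (auto simp: col_def)
      show "j \<noteq> (i + 1) mod n"
        using * ne(2-5)[of i] by (auto simp: col_def)
      show "i \<noteq> (j + 1) mod n"
        using * ne(2-5)[of j] by (auto simp: col_def)
      show "j \<noteq> (i + 2) mod n" if "s = 2"
        using that * ne(6,7)[of i] by (auto simp: col_def)
      show "i \<noteq> (j + 2) mod n" if "t = 2"
        using that * ne(6,7)[of j] by (auto simp: col_def)
    qed
  qed (use assms bij_betw_id in \<open>auto simp: id_def\<close>)
  moreover have "{col i s |i s. i < n \<and> s \<in> {1, 2}} \<subseteq> {..<5}"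
  proof -
    have "a i < 5" "b i < 5" if "i < n" for i
    proof -
      have "xs ! i \<in> {..<5} \<times> {..<5}"
        using set nth_mem[of i xs] that len by blast
      then show "a i < 5" "b i < 5"
        by (auto simp: a_def b_def mem_Times_iff)
    qed
    then show ?thesis by (auto simp: col_def)
  qed
  ultimately show ?thesis
    by (meson subset_trans)
qed

theorem theorem3:
  fixes n :: nat
  assumes "n \<ge> 5"
  shows "nearly_dispersable (circulant n {1, 2})"
proof -
  let ?G = "circulant n {1, 2}"
  obtain \<omega> c where emb: "matching_book_embedding ?G \<omega> c" and col: "c ` edges ?G \<subseteq> {..<5}"
    using circulant_1_2_five_pages[OF assms] by blast
  \<comment> \<open>The number of colors is pinned to 5 by bounds: at most 5 pages, at least the
    degree 4, and exactly 4 would make the graph dispersable.\<close>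
  have "num_colors ?G c \<le> 5"
    using card_mono[OF _ col] by (simp add: num_colors_def)
  moreover have "4 \<le> num_colors ?G c"
    using degree_le_num_colors[OF emb, of 1] degree_circulant_1_2[of n 1] assms
    by (simp add: circulant_def)
  moreover have "num_colors ?G c \<noteq> 4"
    using emb not_dispersable_circulant_1_2[OF assms] max_degree_circulant_1_2[OF assms]
    by (auto simp: dispersable_def)
  ultimately have "num_colors ?G c = 1 + max_degree ?G"
    using max_degree_circulant_1_2[OF assms] by simp
  then show ?thesis
    using emb not_dispersable_circulant_1_2[OF assms] by (auto simp: nearly_dispersable_def)
qed

end
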